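(* Let $G$ be a connected chordal graph, and weight each edge of the reduced clique graph $C_R(G)$, joining maximal cliques $C$ and $C'$, by $|C\cap C'|$. Let $T$ be a spanning tree of $C_R(G)$. Then $T$ is a clique tree of $G$ if and only if $T$ is a maximum-weight spanning tree of $C_R(G)$.
   Context: All graphs are finite and simple. A graph is chordal if every cycle with at least four vertices has a chord (an edge joining two vertices of the cycle that is not in the cycle). A clique is a set of pairwise adjacent vertices; maximal cliques are maximal with respect to inclusion. For a set $S$ of vertices, a path is $S$-avoiding if no internal vertex of the path is in $S$. The reduced clique graph $C_R(G)$ of a chordal graph $G$ has the maximal cliques of $G$ as its vertices; distinct maximal cliques $C$ and $C'$ are adjacent in $C_R(G)$ if and only if $C\cap C'\neq\emptyset$ and $C,C'$ form a separating pair, meaning that there is no $(C\cap C')$-avoiding path of $G$ from a vertex in $C-C'$ to a vertex in $C'-C$. A clique tree of $G$ is a tree $T$ whose vertices are the maximal cliques of $G$ such that, for every $v\in V(G)$, the maximal cliques containing $v$ induce a connected subgraph of $T$. The weight of a spanning tree is the sum of the weights of its edges. *)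

theory Defs
  imports "Graph_Theory.Graph_Theory"
begin

text \<open>
  A finite simple graph is a \<open>pair_graph\<close>: a finite loop-free digraph whose arcs are vertex pairs
  and whose arc relation is symmetric; an edge \<open>{u, v}\<close> is the pair of arcs \<open>(u, v)\<close>, \<open>(v, u)\<close>.
  The predicates \<open>forest\<close>, \<open>tree\<close> and \<open>spanning_tree\<close> of the library speak about directed
  cycles, and \<open>u, v, u\<close> is such a cycle, so no symmetric digraph with an edge is a \<open>tree\<close> in
  that sense. Hence undirected versions are defined here.
\<close>

text \<open>
  In a symmetric loop-free digraph, directed cycles of length at least three are exactly the
  (oriented) cycles of the undirected graph.
\<close>

definition undirected_cycle :: "'a pair_pre_digraph \<Rightarrow> ('a \<times> 'a) list \<Rightarrow> bool" where
  "undirected_cycle G p \<longleftrightarrow> pre_digraph.cycle (with_proj G) p \<and> 3 \<le> length p"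

definition undirected_tree :: "'a pair_pre_digraph \<Rightarrow> bool" where
  "undirected_tree T \<longleftrightarrow>
     pair_graph T \<and> Digraph_Component.connected (with_proj T) \<and> (\<nexists>p. undirected_cycle T p)"

definition undirected_spanning_tree :: "'a pair_pre_digraph \<Rightarrow> 'a pair_pre_digraph \<Rightarrow> bool" where
  "undirected_spanning_tree T H \<longleftrightarrow> undirected_tree T \<and> spanning (with_proj T) (with_proj H)"

definition edges :: "'a pair_pre_digraph \<Rightarrow> 'a set set" where
  "edges G = (\<lambda>(u, v). {u, v}) ` parcs G"

definition weight :: "('a set \<Rightarrow> nat) \<Rightarrow> 'a pair_pre_digraph \<Rightarrow> nat" where
  "weight w T = (\<Sum>e\<in>edges T. w e)"

definition max_weight_spanning_tree ::
  "('a set \<Rightarrow> nat) \<Rightarrow> 'a pair_pre_digraph \<Rightarrow> 'a pair_pre_digraph \<Rightarrow> bool" where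
  "max_weight_spanning_tree w T H \<longleftrightarrow>
     undirected_spanning_tree T H \<and>
     (\<forall>T'. undirected_spanning_tree T' H \<longrightarrow> weight w T' \<le> weight w T)"

text \<open>
  The length of a cycle, given as a list of arcs, is its number of vertices. A chord lies on the
  cycle in neither orientation.
\<close>

definition chordal :: "'a pair_pre_digraph \<Rightarrow> bool" where
  "chordal G \<longleftrightarrow>
     (\<forall>p. undirected_cycle G p \<and> 4 \<le> length p \<longrightarrow>
        (\<exists>x\<in>fst ` set p. \<exists>y\<in>fst ` set p.
           (x, y) \<in> parcs G \<and> (x, y) \<notin> set p \<and> (y, x) \<notin> set p))"

definition clique :: "'a pair_pre_digraph \<Rightarrow> 'a set \<Rightarrow> bool" where
  "clique G K \<longleftrightarrow> K \<subseteq> pverts G \<and> (\<forall>u\<in>K. \<forall>v\<in>K. u \<noteq> v \<longrightarrow> (u, v) \<in> parcs G)"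

definition maximal_cliques :: "'a pair_pre_digraph \<Rightarrow> 'a set set" where
  "maximal_cliques G = {K. clique G K \<and> (\<forall>K'. clique G K' \<and> K \<subseteq> K' \<longrightarrow> K' = K)}"

definition avoiding_path ::
  "'a pair_pre_digraph \<Rightarrow> 'a set \<Rightarrow> 'a \<Rightarrow> ('a \<times> 'a) list \<Rightarrow> 'a \<Rightarrow> bool" where
  "avoiding_path G S u p v \<longleftrightarrow>
     pre_digraph.apath (with_proj G) u p v \<and>
     set (pre_digraph.inner_verts (with_proj G) p) \<inter> S = {}"

definition separating_pair :: "'a pair_pre_digraph \<Rightarrow> 'a set \<Rightarrow> 'a set \<Rightarrow> bool" where
  "separating_pair G C C' \<longleftrightarrow>
     \<not> (\<exists>u\<in>C - C'. \<exists>v\<in>C' - C. \<exists>p. avoiding_path G (C \<inter> C') u p v)"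

definition reduced_clique_graph :: "'a pair_pre_digraph \<Rightarrow> 'a set pair_pre_digraph" where
  "reduced_clique_graph G =
     \<lparr> pverts = maximal_cliques G,
       parcs = {(C, C'). C \<in> maximal_cliques G \<and> C' \<in> maximal_cliques G \<and> C \<noteq> C' \<and>
                         C \<inter> C' \<noteq> {} \<and> separating_pair G C C'} \<rparr>"

text \<open>For an edge \<open>e = {C, C'}\<close> this is the cardinality of \<open>C \<inter> C'\<close>.\<close>

definition intersection_weight :: "'a set set \<Rightarrow> nat" where
  "intersection_weight e = card (\<Inter>e)"

definition clique_tree :: "'a pair_pre_digraph \<Rightarrow> 'a set pair_pre_digraph \<Rightarrow> bool" where
  "clique_tree G T \<longleftrightarrow>
     undirected_tree T \<and> pverts T = maximal_cliques G \<and>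
     (\<forall>v\<in>pverts G. Digraph_Component.connected
                      (with_proj T \<restriction> {K \<in> maximal_cliques G. v \<in> K}))"

end

theory Submission
  imports Defs
begin

text \<open>
  The weight of a spanning tree \<open>T\<close> counts, over all vertices \<open>v\<close> of \<open>G\<close>, the edges of \<open>T\<close> inside
  the family of maximal cliques that contain \<open>v\<close> (\<open>weight_eq_sum_vertices\<close>). On a family of \<open>k\<close>
  cliques a forest has at most \<open>k - 1\<close> edges and a connected graph at least \<open>k - 1\<close>. In a clique
  tree every such family is connected, so every summand is as large as possible and no spanning
  tree weighs more (\<open>weight_le_weight_clique_tree\<close>).

  Conversely let \<open>T\<close> have maximum weight. A stronger statement is proved by downward induction on
  \<open>S\<close>: for each nonempty \<open>S\<close>, the maximal cliques that contain \<open>S\<close> induce a connected subgraph of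
  \<open>T\<close> (\<open>max_weight_cliques_containing_connected\<close>). Let \<open>C\<close> and \<open>D\<close> be two of them. If
  \<open>C \<inter> D\<close> is larger than \<open>S\<close>, the induction hypothesis for \<open>C \<inter> D\<close> connects them. Let
  \<open>C \<inter> D = S\<close>.

  If \<open>C, D\<close> is not a separating pair, take an induced path outside \<open>S\<close> from \<open>C - S\<close> to \<open>D - S\<close>. By
  chordality every vertex of \<open>S\<close> is adjacent to the whole path, so \<open>S\<close> together with two
  consecutive path vertices is a clique. Maximal cliques around these form a chain from \<open>C\<close> to
  \<open>D\<close> with consecutive intersections larger than \<open>S\<close> (\<open>clique_chain_if_not_separating\<close>), and the
  induction hypothesis applies to each of its steps.

  If \<open>C, D\<close> is a separating pair, it is an edge of the reduced clique graph, and exchanging tree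
  edges shows that \<open>T\<close> joins \<open>C\<close> to \<open>D\<close> by edges of weight at least the cardinality of \<open>S\<close>
  (\<open>max_weight_bottleneck\<close>). Cut this walk at its edges whose intersection is exactly \<open>S\<close>. The other
  edges have intersections not contained in \<open>S\<close>, so along each remaining segment one can walk in
  \<open>G\<close> outside \<open>S\<close> (\<open>avoiding_walk_along_cliques\<close>). The two ends of a segment both contain \<open>S\<close> and
  are no separating pair with intersection \<open>S\<close>, hence they are connected by the previous cases.
\<close>

section \<open>Symmetric relations all of whose edges are bridges\<close>

definition unordered_pairs :: "('b \<times> 'b) set \<Rightarrow> 'b set set" where
  "unordered_pairs R = (\<lambda>(x, y). {x, y}) ` R"

definition delete_edge :: "('b \<times> 'b) set \<Rightarrow> 'b \<Rightarrow> 'b \<Rightarrow> ('b \<times> 'b) set" where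
  "delete_edge R x y = R - {(x, y), (y, x)}"

text \<open>
  For a symmetric relation this says that the graph is a forest. Unlike the absence of a closed
  list of arcs, it behaves well under deleting and adding edges.
\<close>

definition all_bridges :: "('b \<times> 'b) set \<Rightarrow> bool" where
  "all_bridges R \<longleftrightarrow> (\<forall>x y. (x, y) \<in> R \<longrightarrow> (x, y) \<notin> (delete_edge R x y)\<^sup>*)"

lemma all_bridges_irrefl: "all_bridges R \<Longrightarrow> (x, x) \<notin> R"
  by (auto simp: all_bridges_def)

lemma all_bridges_mono:
  assumes "all_bridges R" "Q \<subseteq> R"
  shows "all_bridges Q"
proof -
  have "(delete_edge Q x y)\<^sup>* \<subseteq> (delete_edge R x y)\<^sup>*" for x y
    using assms(2) by (intro rtrancl_mono) (auto simp: delete_edge_def)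
  then show ?thesis using assms unfolding all_bridges_def by blast
qed

lemma sym_delete_edge: "sym R \<Longrightarrow> sym (delete_edge R x y)"
  by (auto simp: sym_def delete_edge_def)

lemma sym_rtranclD: "sym R \<Longrightarrow> (x, y) \<in> R\<^sup>* \<Longrightarrow> (y, x) \<in> R\<^sup>*"
  by (metis sym_rtrancl symD)

lemma finite_unordered_pairs: "finite R \<Longrightarrow> finite (unordered_pairs R)"
  by (simp add: unordered_pairs_def)

lemma mem_unordered_pairs: "sym R \<Longrightarrow> {x, y} \<in> unordered_pairs R \<longleftrightarrow> (x, y) \<in> R"
  by (auto simp: unordered_pairs_def doubleton_eq_iff sym_def split: prod.splits)

lemma unordered_pairs_delete_edge:
  assumes "sym R" "(x, y) \<in> R"
  shows "unordered_pairs R = insert {x, y} (unordered_pairs (delete_edge R x y))"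
    "{x, y} \<notin> unordered_pairs (delete_edge R x y)"
  using assms by (auto simp: unordered_pairs_def delete_edge_def doubleton_eq_iff sym_def)

text \<open>
  Consider where a walk from \<open>c\<close> to \<open>d\<close> first meets the edge \<open>{a, b}\<close> and where it finally leaves
  it. If both happened at the same end, the part of the walk in between could be skipped.
\<close>

lemma rtrancl_delete_edge_cases:
  assumes "sym R" "(c, d) \<in> R\<^sup>*" "(c, d) \<notin> (delete_edge R a b)\<^sup>*"
  shows "(c, a) \<in> (delete_edge R a b)\<^sup>* \<and> (b, d) \<in> (delete_edge R a b)\<^sup>* \<or>
         (c, b) \<in> (delete_edge R a b)\<^sup>* \<and> (a, d) \<in> (delete_edge R a b)\<^sup>*"
proof -
  let ?Q = "delete_edge R a b"
  have "(c, d) \<in> ?Q\<^sup>* \<or> (c, a) \<in> ?Q\<^sup>* \<and> (b, d) \<in> ?Q\<^sup>* \<or> (c, b) \<in> ?Q\<^sup>* \<and> (a, d) \<in> ?Q\<^sup>*"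
    using assms(2)
  proof (induction rule: rtrancl_induct)
    case base
    then show ?case by simp
  next
    case (step y z)
    then consider "(y, z) \<in> ?Q" | "y = a" "z = b" | "y = b" "z = a"
      by (auto simp: delete_edge_def)
    then show ?case
    proof cases
      case 1
      then show ?thesis using step.IH by (meson rtrancl.rtrancl_into_rtrancl)
    next
      case 2
      then show ?thesis using step.IH sym_rtranclD[OF sym_delete_edge[OF assms(1)]]
        by (metis rtrancl.rtrancl_refl rtrancl_trans)
    next
      case 3
      then show ?thesis using step.IH sym_rtranclD[OF sym_delete_edge[OF assms(1)]]
        by (metis rtrancl.rtrancl_refl rtrancl_trans)
    qed
  qed
  with assms(3) show ?thesis by blast
qed

text \<open>
  Removing a bridge \<open>{a, b}\<close> splits the vertices into the component \<open>A\<close> of \<open>a\<close> and the rest, which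
  contains \<open>b\<close>. Both parts carry smaller forests, and the two strict inequalities leave room for
  the removed edge.
\<close>

lemma all_bridges_card_less:
  assumes "finite V" "V \<noteq> {}" "R \<subseteq> V \<times> V" "sym R" "all_bridges R"
  shows "card (unordered_pairs R) < card V"
  using assms
proof (induction "card V" arbitrary: V R rule: less_induct)
  case less
  show ?case
  proof (cases "R = {}")
    case True
    then show ?thesis using less.prems by (simp add: unordered_pairs_def card_gt_0_iff)
  next
    case False
    then obtain a b where ab: "(a, b) \<in> R" by auto
    define Q where "Q = delete_edge R a b"
    define A where "A = {x \<in> V. (a, x) \<in> Q\<^sup>*}"
    have symQ: "sym Q" unfolding Q_def by (rule sym_delete_edge) fact
    have QR: "Q \<subseteq> R" by (auto simp: Q_def delete_edge_def)
    have inV: "a \<in> V" "b \<in> V" using ab less.prems by auto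
    have "b \<notin> A" using less.prems(5) ab by (auto simp: A_def Q_def all_bridges_def)
    moreover have "a \<in> A" using inV by (simp add: A_def)
    ultimately have sub: "A \<subset> V" "V - A \<subset> V" "A \<noteq> {}" "V - A \<noteq> {}"
      using inV by (auto simp: A_def)
    have split: "x \<in> A \<longleftrightarrow> y \<in> A" if "(x, y) \<in> Q" for x y
    proof -
      have "x \<in> V" "y \<in> V" "(y, x) \<in> Q"
        using that QR less.prems(3) symQ by (auto dest: symD)
      then show ?thesis using that
        unfolding A_def by (auto intro: rtrancl_into_rtrancl)
    qed
    have QV: "Q \<subseteq> V \<times> V" using QR less.prems(3) by blast
    let ?QA = "Q \<inter> A \<times> A" and ?QB = "Q \<inter> (V - A) \<times> (V - A)"
    have "card (unordered_pairs (Q \<inter> X \<times> X)) < card X" if "X \<subset> V" "X \<noteq> {}" for X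
    proof (rule less.hyps)
      show "card X < card V" using that less.prems(1) by (simp add: psubset_card_mono)
      show "finite X" using that less.prems(1) by (meson finite_subset psubset_imp_subset)
      show "sym (Q \<inter> X \<times> X)" using symQ by (auto simp: sym_def)
      show "all_bridges (Q \<inter> X \<times> X)"
        using less.prems(5) QR by (auto intro: all_bridges_mono)
    qed (use that in auto)
    then have cards: "card (unordered_pairs ?QA) < card A" "card (unordered_pairs ?QB) < card (V - A)"
      using sub by blast+
    have "Q = ?QA \<union> ?QB" using split QV by blast
    then have "unordered_pairs Q = unordered_pairs ?QA \<union> unordered_pairs ?QB"
      unfolding unordered_pairs_def by (metis image_Un)
    then have "card (unordered_pairs Q) \<le> card (unordered_pairs ?QA) + card (unordered_pairs ?QB)"
      by (simp add: card_Un_le)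
    moreover have "card (unordered_pairs R) \<le> Suc (card (unordered_pairs Q))"
      unfolding unordered_pairs_delete_edge(1)[OF less.prems(4) ab] Q_def
      by (rule card_insert_le_m1[THEN le_trans]) auto
    moreover have "card A + card (V - A) = card V"
      using sub(1) less.prems(1) by (metis card_Diff_subset card_mono finite_subset le_add_diff_inverse psubset_imp_subset)
    ultimately show ?thesis using cards by linarith
  qed
qed

text \<open>
  Grow a vertex set from one vertex to all of \<open>V\<close>, one vertex at a time. By connectedness some edge
  leaves the set built so far, so each new vertex brings at least one new edge.
\<close>

lemma connected_card_le:
  assumes "finite V" "V \<noteq> {}" "R \<subseteq> V \<times> V" "\<And>u v. u \<in> V \<Longrightarrow> v \<in> V \<Longrightarrow> (u, v) \<in> R\<^sup>*"
  shows "card V \<le> Suc (card (unordered_pairs R))"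
proof -
  have finR: "finite R" using assms(1,3) by (meson finite_SigmaI finite_subset)
  have grow: "\<exists>X\<subseteq>V. card X = Suc n \<and> n \<le> card (unordered_pairs (R \<inter> X \<times> X))" if "Suc n \<le> card V" for n
    using that
  proof (induction n)
    case 0
    obtain v where "v \<in> V" using assms(2) by blast
    then show ?case by (intro exI[of _ "{v}"]) auto
  next
    case (Suc n)
    then obtain X where X: "X \<subseteq> V" "card X = Suc n" "n \<le> card (unordered_pairs (R \<inter> X \<times> X))"
      by auto
    then have "X \<noteq> V" "X \<noteq> {}" using Suc.prems by auto
    then obtain x v where xv: "x \<in> X" "v \<in> V - X" using X by blast
    then have "(x, v) \<in> R\<^sup>*" using X(1) assms(4) by blast
    then have "v \<notin> X \<longrightarrow> (\<exists>y z. (y, z) \<in> R \<and> y \<in> X \<and> z \<notin> X)"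
      using xv(1) by (induction rule: rtrancl_induct) auto
    then obtain y z where yz: "(y, z) \<in> R" "y \<in> X" "z \<notin> X" using xv(2) by blast
    let ?X = "insert z X"
    have fin: "finite (unordered_pairs (R \<inter> ?X \<times> ?X))" using finR by (simp add: finite_unordered_pairs)
    have "insert {y, z} (unordered_pairs (R \<inter> X \<times> X)) \<subseteq> unordered_pairs (R \<inter> ?X \<times> ?X)"
      using yz by (auto simp: unordered_pairs_def)
    moreover have "{y, z} \<notin> unordered_pairs (R \<inter> X \<times> X)"
      using yz by (auto simp: unordered_pairs_def doubleton_eq_iff)
    moreover have "finite (unordered_pairs (R \<inter> X \<times> X))" using finR by (simp add: finite_unordered_pairs)
    ultimately have "Suc (card (unordered_pairs (R \<inter> X \<times> X))) \<le> card (unordered_pairs (R \<inter> ?X \<times> ?X))"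
      using card_mono[OF fin] by (metis card_insert_disjoint)
    then have "Suc n \<le> card (unordered_pairs (R \<inter> ?X \<times> ?X))" using X(3) by linarith
    moreover have "?X \<subseteq> V" using X(1) yz(1) assms(3) by blast
    moreover have "card ?X = Suc (Suc n)"
      using X yz(3) assms(1) by (metis card_insert_disjoint finite_subset)
    ultimately show ?case by blast
  qed
  have "Suc (card V - 1) = card V" using assms(1,2) by (simp add: card_gt_0_iff)
  then obtain X where X: "X \<subseteq> V" "card V - 1 \<le> card (unordered_pairs (R \<inter> X \<times> X))"
    using grow[of "card V - 1"] by auto
  have "unordered_pairs (R \<inter> X \<times> X) \<subseteq> unordered_pairs R" by (auto simp: unordered_pairs_def)
  then have "card (unordered_pairs (R \<inter> X \<times> X)) \<le> card (unordered_pairs R)"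
    using finR by (intro card_mono finite_unordered_pairs)
  then show ?thesis using X(2) by linarith
qed

text \<open>
  This and the next lemma are the exchange step for trees: an edge \<open>{a, b}\<close> that separates \<open>c\<close> from
  \<open>d\<close> may be replaced by \<open>{c, d}\<close>. The new edge reconnects the ends of the old one.
\<close>

lemma exchange_connected:
  assumes "sym R" "(c, d) \<in> R\<^sup>*" "(c, d) \<notin> (delete_edge R a b)\<^sup>*" "(u, v) \<in> R\<^sup>*"
  shows "(u, v) \<in> (delete_edge R a b \<union> {(c, d), (d, c)})\<^sup>*"
proof -
  let ?Q = "delete_edge R a b" and ?R = "delete_edge R a b \<union> {(c, d), (d, c)}"
  have symR': "sym ?R" using sym_delete_edge[OF assms(1), of a b] by (auto simp: sym_def)
  have mono: "(x, y) \<in> ?R\<^sup>*" if "(x, y) \<in> ?Q\<^sup>*" for x y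
    using that rtrancl_mono[of ?Q ?R] by blast
  have cd: "(c, d) \<in> ?R\<^sup>*" "(d, c) \<in> ?R\<^sup>*" by auto
  have ab: "(a, b) \<in> ?R\<^sup>*"
    using rtrancl_delete_edge_cases[OF assms(1-3)]
    by (meson cd mono rtrancl_trans sym_rtranclD symR')
  have "R \<subseteq> ?R\<^sup>*"
    using ab sym_rtranclD[OF symR' ab] mono by (auto simp: delete_edge_def)
  then have "R\<^sup>* \<subseteq> ?R\<^sup>*" by (rule rtrancl_subset_rtrancl)
  then show ?thesis using assms(4) by blast
qed

text \<open>
  If an old edge \<open>{x, y}\<close> stopped being a bridge, its detour would use \<open>{c, d}\<close>. The rest of the
  detour together with \<open>{x, y}\<close> would then join \<open>c\<close> to \<open>d\<close> without the deleted edge.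
\<close>

lemma exchange_all_bridges:
  assumes "sym R" "all_bridges R" "(c, d) \<notin> (delete_edge R a b)\<^sup>*"
  shows "all_bridges (delete_edge R a b \<union> {(c, d), (d, c)})"
  unfolding all_bridges_def
proof (intro allI impI notI)
  let ?Q = "delete_edge R a b" and ?R = "delete_edge R a b \<union> {(c, d), (d, c)}"
  fix x y assume xy: "(x, y) \<in> ?R" and path: "(x, y) \<in> (delete_edge ?R x y)\<^sup>*"
  have symQ: "sym ?Q" by (rule sym_delete_edge) fact
  have symR': "sym ?R" using symQ by (auto simp: sym_def)
  show False
  proof (cases "{x, y} = {c, d}")
    case True
    then have "delete_edge ?R x y \<subseteq> ?Q" by (auto simp: delete_edge_def doubleton_eq_iff)
    then have "(x, y) \<in> ?Q\<^sup>*" using path rtrancl_mono by blast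
    then show False using True assms(3) sym_rtranclD[OF symQ]
      by (auto simp: doubleton_eq_iff)
  next
    case False
    then have xyQ: "(x, y) \<in> ?Q" using xy by auto
    let ?P = "delete_edge ?Q x y"
    have PR: "?P \<subseteq> delete_edge R x y" "?P \<subseteq> ?Q" by (auto simp: delete_edge_def)
    have no: "(x, y) \<notin> ?P\<^sup>*"
      using xyQ assms(2) rtrancl_mono[OF PR(1)] by (auto simp: all_bridges_def delete_edge_def)
    have eq: "delete_edge (delete_edge ?R x y) c d = delete_edge ?P c d"
      by (auto simp: delete_edge_def)
    have Pcd: "(delete_edge ?P c d)\<^sup>* \<subseteq> ?P\<^sup>*" by (intro rtrancl_mono) (auto simp: delete_edge_def)
    have "(x, y) \<notin> (delete_edge ?P c d)\<^sup>*" using no Pcd by blast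
    then have "(x, c) \<in> ?P\<^sup>* \<and> (d, y) \<in> ?P\<^sup>* \<or> (x, d) \<in> ?P\<^sup>* \<and> (c, y) \<in> ?P\<^sup>*"
      using rtrancl_delete_edge_cases[OF sym_delete_edge[OF symR'] path, of c d] eq Pcd by auto
    then have "(x, c) \<in> ?Q\<^sup>* \<and> (d, y) \<in> ?Q\<^sup>* \<or> (x, d) \<in> ?Q\<^sup>* \<and> (c, y) \<in> ?Q\<^sup>*"
      using rtrancl_mono[OF PR(2)] by blast
    then have "(c, d) \<in> ?Q\<^sup>*"
      using xyQ sym_rtranclD[OF symQ] by (meson r_into_rtrancl rtrancl_trans)
    then show False using assms(3) by blast
  qed
qed

text \<open>
  The edges of a forest that separate \<open>c\<close> from \<open>d\<close> are those on the unique path between them, so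
  if \<open>Q\<close> does not join \<open>c\<close> to \<open>d\<close>, one of them lies outside \<open>Q\<close>. To find it without speaking about
  paths, take a smallest \<open>X\<close> between \<open>Q\<close> and \<open>R\<close> that still joins \<open>c\<close> to \<open>d\<close>. Each edge of
  \<open>X - Q\<close> is needed in \<open>X\<close>, and then also in \<open>R\<close>, because it is a bridge there.
\<close>

lemma bridge_outside:
  assumes "finite R" "sym R" "all_bridges R" "Q \<subseteq> R" "sym Q" "(c, d) \<in> R\<^sup>*" "(c, d) \<notin> Q\<^sup>*"
  shows "\<exists>a b. (a, b) \<in> R - Q \<and> (c, d) \<notin> (delete_edge R a b)\<^sup>*"
proof -
  define P where "P X \<longleftrightarrow> Q \<subseteq> X \<and> X \<subseteq> R \<and> sym X \<and> (c, d) \<in> X\<^sup>*" for X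
  have "P R" using assms by (simp add: P_def)
  then obtain X where X: "P X" and least: "\<And>Y. P Y \<Longrightarrow> card X \<le> card Y"
    using ex_has_least_nat[of P R card] by blast
  have finX: "finite X" using X assms(1) by (auto simp: P_def intro: finite_subset)
  have "X \<noteq> Q" using X assms(7) by (auto simp: P_def)
  then obtain a b where ab: "(a, b) \<in> X - Q" using X by (auto simp: P_def)
  let ?Y = "delete_edge X a b"
  have "card ?Y < card X"
    using ab finX by (intro psubset_card_mono) (auto simp: delete_edge_def)
  then have "\<not> P ?Y" using least by (meson leD)
  moreover have "Q \<subseteq> ?Y" using X ab assms(5) by (auto simp: P_def delete_edge_def dest: symD)
  ultimately have no: "(c, d) \<notin> ?Y\<^sup>*"
    using X sym_delete_edge[of X a b] by (auto simp: P_def delete_edge_def)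
  have symY: "sym ?Y" using X by (auto simp: P_def intro: sym_delete_edge)
  have cases: "(c, a) \<in> ?Y\<^sup>* \<and> (b, d) \<in> ?Y\<^sup>* \<or> (c, b) \<in> ?Y\<^sup>* \<and> (a, d) \<in> ?Y\<^sup>*"
    using rtrancl_delete_edge_cases[OF _ _ no] X by (auto simp: P_def)
  let ?Z = "delete_edge R a b"
  have YZ: "?Y\<^sup>* \<subseteq> ?Z\<^sup>*" using X by (intro rtrancl_mono) (auto simp: P_def delete_edge_def)
  have symZ: "sym ?Z" by (rule sym_delete_edge) fact
  have abR: "(a, b) \<in> R" using ab X by (auto simp: P_def)
  have "(c, d) \<notin> ?Z\<^sup>*"
  proof
    assume "(c, d) \<in> ?Z\<^sup>*"
    then have "(a, b) \<in> ?Z\<^sup>*" using cases YZ sym_rtranclD[OF symZ]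
      by (meson rtrancl_trans subsetD)
    then show False using assms(3) abR by (auto simp: all_bridges_def)
  qed
  then show ?thesis using abR ab by blast
qed

section \<open>Undirected trees as relations\<close>

lemma connected_iff_rtrancl:
  assumes "wf_digraph H" "sym (arcs_ends H)"
  shows "Digraph_Component.connected H \<longleftrightarrow>
         verts H \<noteq> {} \<and> (\<forall>u\<in>verts H. \<forall>v\<in>verts H. (u, v) \<in> (arcs_ends H)\<^sup>*)"
proof -
  interpret wf_digraph H by fact
  have "symcl (arcs_ends H) = arcs_ends H"
    using assms(2) by (auto simp: symcl_def sym_def)
  then have "Digraph_Component.connected H \<longleftrightarrow>
         verts H \<noteq> {} \<and> (\<forall>u\<in>verts H. \<forall>v\<in>verts H. u \<rightarrow>\<^sup>*\<^bsub>H\<^esub> v)"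
    by (simp add: connected_conv reachable_def)
  then show ?thesis using reachable_conv by auto
qed

lemma pair_graph_sym: "pair_graph H \<Longrightarrow> sym (parcs H)"
  using pair_sym_digraph.pair_sym_arcs[of H] pair_pseudo_graph.axioms(2) pair_graph.axioms(2)
  by (fastforce simp: symmetric_def)

lemma pair_graph_irrefl: "pair_graph H \<Longrightarrow> (x, x) \<notin> parcs H"
  using pair_loopfree_digraph.pair_no_loops pair_digraph.axioms(2) pair_graph.axioms(1) by fastforce

lemma pair_graph_subset: "pair_graph H \<Longrightarrow> parcs H \<subseteq> pverts H \<times> pverts H"
  using pair_wf_digraph.wellformed' pair_loopfree_digraph.axioms(1) pair_digraph.axioms(2) pair_graph.axioms(1)
  by fastforce

lemma pair_graph_finite: "pair_graph H \<Longrightarrow> finite (pverts H)"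
  using pair_fin_digraph.pair_finite_verts pair_digraph.axioms(1) pair_graph.axioms(1) by blast

lemma pair_graphI:
  assumes "finite (pverts H)" "parcs H \<subseteq> pverts H \<times> pverts H" "sym (parcs H)" "\<And>x. (x, x) \<notin> parcs H"
  shows "pair_graph H"
proof -
  have "finite (parcs H)" using assms(1,2) by (meson finite_SigmaI finite_subset)
  then show ?thesis using assms
    by unfold_locales (auto simp: symmetric_def)
qed

lemma connected_pair_graph_iff:
  assumes "pair_graph H"
  shows "Digraph_Component.connected (with_proj H) \<longleftrightarrow>
         pverts H \<noteq> {} \<and> (\<forall>u\<in>pverts H. \<forall>v\<in>pverts H. (u, v) \<in> (parcs H)\<^sup>*)"
proof -
  interpret pair_graph H by fact
  show ?thesis
    using connected_iff_rtrancl[of "with_proj H"] pair_graph_sym[OF assms] wf_digraph by simp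
qed

lemma connected_induced_iff:
  assumes "pair_graph H"
  shows "Digraph_Component.connected (with_proj H \<restriction> X) \<longleftrightarrow>
         X \<noteq> {} \<and> (\<forall>u\<in>X. \<forall>v\<in>X. (u, v) \<in> (parcs H \<inter> X \<times> X)\<^sup>*)"
proof -
  interpret pair_graph H by fact
  let ?I = "with_proj H \<restriction> X"
  have ends: "arcs_ends ?I = parcs H \<inter> X \<times> X"
    by (auto simp: arcs_ends_conv induce_subgraph_def)
  have "wf_digraph ?I"
    by unfold_locales (auto simp: induce_subgraph_def)
  moreover have "sym (arcs_ends ?I)"
    unfolding ends using pair_graph_sym[OF assms] by (auto simp: sym_def)
  ultimately show ?thesis
    using connected_iff_rtrancl[of ?I] unfolding ends by (simp add: induce_subgraph_def)
qed

lemma rtrancl_if_pcas: "pcas u p v \<Longrightarrow> set p \<subseteq> R \<Longrightarrow> (u, v) \<in> R\<^sup>*"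
  by (induction u p v rule: pcas.induct) (auto intro: converse_rtrancl_into_rtrancl)

text \<open>
  The path is found in the digraph on all elements of the type, where every element is a vertex and
  the relation need not be restricted.
\<close>

lemma distinct_path_if_rtrancl:
  assumes "(u, v) \<in> R\<^sup>*"
  shows "\<exists>p. set p \<subseteq> R \<and> pcas u p v \<and> distinct (pawalk_verts u p)"
proof -
  interpret pair_wf_digraph "\<lparr>pverts = UNIV, parcs = R\<rparr>"
    by unfold_locales auto
  have "u \<rightarrow>\<^sup>*\<^bsub>with_proj \<lparr>pverts = UNIV, parcs = R\<rparr>\<^esub> v"
    using assms reachable_conv by simp
  then show ?thesis
    unfolding reachable_apath by (auto simp: apath_def awalk_def)
qed

lemma undirected_cycle_iff:
  "undirected_cycle H p \<longleftrightarrow>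
   (\<exists>u\<in>pverts H. set p \<subseteq> parcs H \<and> pcas u p u \<and> distinct (tl (pawalk_verts u p))) \<and> 3 \<le> length p"
  unfolding undirected_cycle_def pre_digraph.cycle_def pre_digraph.awalk_def
  by (auto simp: cas_with_proj_eq awalk_verts_with_proj_eq)

lemma fst_in_pawalk_verts: "e \<in> set p \<Longrightarrow> fst e \<in> set (pawalk_verts u p)"
  by (induction p arbitrary: u) auto

lemma snd_in_pawalk_verts: "pcas u p v \<Longrightarrow> e \<in> set p \<Longrightarrow> snd e \<in> set (pawalk_verts u p)"
proof (induction u p v rule: pcas.induct)
  case (2 u e' es v)
  then show ?case by (cases es) auto
qed auto

lemma last_in_pawalk_verts: "pcas u p v \<Longrightarrow> v \<in> set (pawalk_verts u p)"
  by (induction p arbitrary: u) auto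

text \<open>
  A detour around an edge closes up with it to a cycle, and a cycle without one of its edges is a
  detour around that edge. Length at least three is what distinguishes this from walking along one
  edge and back.
\<close>

lemma acyclic_iff_all_bridges:
  assumes "pair_graph H"
  shows "(\<nexists>p. undirected_cycle H p) \<longleftrightarrow> all_bridges (parcs H)"
proof
  assume acyc: "\<nexists>p. undirected_cycle H p"
  show "all_bridges (parcs H)" unfolding all_bridges_def
  proof (intro allI impI notI)
    fix x y assume xy: "(x, y) \<in> parcs H" and "(x, y) \<in> (delete_edge (parcs H) x y)\<^sup>*"
    then obtain p where p: "set p \<subseteq> delete_edge (parcs H) x y" "pcas x p y" "distinct (pawalk_verts x p)"
      using distinct_path_if_rtrancl by metis
    have "p \<noteq> []" using p(2) xy pair_graph_irrefl[OF assms] by auto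
    moreover have "length p \<noteq> 1"
    proof
      assume "length p = 1"
      then obtain e where "p = [e]" by (auto simp: length_Suc_conv)
      then show False using p by (auto simp: delete_edge_def)
    qed
    ultimately have "3 \<le> length ((y, x) # p)" by (cases p) (auto simp: Suc_le_eq)
    moreover have "(y, x) \<in> parcs H" using xy pair_graph_sym[OF assms] by (auto dest: symD)
    ultimately have "undirected_cycle H ((y, x) # p)"
      unfolding undirected_cycle_iff using p pair_graph_subset[OF assms]
      by (auto simp: delete_edge_def intro!: bexI[of _ y])
    then show False using acyc by blast
  qed
next
  assume bridges: "all_bridges (parcs H)"
  show "\<nexists>p. undirected_cycle H p"
  proof
    assume "\<exists>p. undirected_cycle H p"
    then obtain u p where p: "set p \<subseteq> parcs H" "pcas u p u" "distinct (tl (pawalk_verts u p))" "3 \<le> length p"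
      unfolding undirected_cycle_iff by blast
    then obtain v w es where es: "p = (u, v) # (v, w) # es"
      by (cases p rule: list.exhaust; cases "tl p"; fastforce)
    have es_props: "pcas w es u" "distinct (v # pawalk_verts w es)" "es \<noteq> []"
      using p es by auto
    \<comment> \<open>The rest of the cycle uses \<open>{u, v}\<close> in neither direction: it leaves \<open>v\<close> for \<open>w \<noteq> u\<close> and
       never returns to \<open>v\<close>.\<close>
    have "w \<noteq> u" using es_props by (cases es) (auto dest: last_in_pawalk_verts)
    moreover have "u \<noteq> v" using p es all_bridges_irrefl[OF bridges] by auto
    moreover have "(u, v) \<notin> set es" "(v, u) \<notin> set es"
      using es_props snd_in_pawalk_verts[OF es_props(1)] fst_in_pawalk_verts by fastforce+
    ultimately have "set ((v, w) # es) \<subseteq> delete_edge (parcs H) u v"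
      using p(1) unfolding es delete_edge_def by auto
    then have "(v, u) \<in> (delete_edge (parcs H) u v)\<^sup>*"
      using es_props by (intro rtrancl_if_pcas[of _ "(v, w) # es"]) auto
    then have "(u, v) \<in> (delete_edge (parcs H) u v)\<^sup>*"
      by (rule sym_rtranclD[OF sym_delete_edge[OF pair_graph_sym[OF assms]]])
    then show False using bridges p es by (auto simp: all_bridges_def)
  qed
qed

lemma undirected_tree_iff:
  "undirected_tree H \<longleftrightarrow> pair_graph H \<and> pverts H \<noteq> {} \<and>
     (\<forall>u\<in>pverts H. \<forall>v\<in>pverts H. (u, v) \<in> (parcs H)\<^sup>*) \<and> all_bridges (parcs H)"
  unfolding undirected_tree_def using acyclic_iff_all_bridges connected_pair_graph_iff by blast

section \<open>Maximal cliques of a chordal graph\<close>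

lemma shortest_walk:
  assumes "(u, v) \<in> R\<^sup>*"
  obtains f :: "nat \<Rightarrow> 'b" and n where "f 0 = u" "f n = v" "\<And>i. i < n \<Longrightarrow> (f i, f (Suc i)) \<in> R"
    "inj_on f {..n}" "\<And>i j. Suc i < j \<Longrightarrow> j \<le> n \<Longrightarrow> (f i, f j) \<notin> R"
proof -
  define n where "n = (LEAST n. (u, v) \<in> R ^^ n)"
  have "(u, v) \<in> R ^^ n"
    unfolding n_def using assms by (metis LeastI_ex rtrancl_power)
  then obtain f where f: "f 0 = u" "f n = v" "\<And>i. i < n \<Longrightarrow> (f i, f (Suc i)) \<in> R"
    by (auto simp: relpow_fun_conv)
  have least: "n \<le> m" if "(u, v) \<in> R ^^ m" for m
    unfolding n_def using that by (rule Least_le)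
  have sub: "(f i, f j) \<in> R ^^ (j - i)" if "i \<le> j" "j \<le> n" for i j
    unfolding relpow_fun_conv using that f(3) by (intro exI[of _ "\<lambda>k. f (i + k)"]) auto
  have shortcut: "j \<le> i + k" if "i \<le> n" "j \<le> n" "(f i, f j) \<in> R ^^ k" for i j k
  proof -
    have "(u, v) \<in> R ^^ (i + k + (n - j))"
      using sub[of 0 i] sub[of j n] that f(1,2) unfolding relpow_add by auto
    then have "n \<le> i + k + (n - j)" by (rule least)
    then show ?thesis using that by linarith
  qed
  show thesis
  proof (rule that[of f n])
    show "inj_on f {..n}"
    proof (rule inj_onI)
      fix i j assume "i \<in> {..n}" "j \<in> {..n}" "f i = f j"
      then show "i = j" using shortcut[of i j 0] shortcut[of j i 0] by simp
    qed
    show "(f i, f j) \<notin> R" if "Suc i < j" "j \<le> n" for i j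
      using shortcut[of i j 1] that by auto
  qed (use f in auto)
qed

lemma pcas_consecutive:
  "i \<le> j \<Longrightarrow> pcas (f i) (map (\<lambda>l. (f l, f (Suc l))) [i..<j] @ q) v \<longleftrightarrow> pcas (f j) q v"
proof (induction "j - i" arbitrary: i)
  case (Suc k)
  then show ?case by (simp add: upt_rec)
qed simp

lemma pawalk_verts_eq: "pawalk_verts u p = (if p = [] then [u] else map fst p @ [snd (last p)])"
  by (induction p arbitrary: u) auto

text \<open>
  The vertex \<open>s\<close> closes the induced path to a cycle. If the path has an interior vertex, this cycle
  has length at least four, and as the path is induced, a chord can only join \<open>s\<close> to an interior
  vertex. That vertex splits the path into two shorter ones, to which induction applies.
\<close>

lemma chordal_adjacent_to_induced_path:
  assumes "pair_graph G" "chordal G"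
    and "\<And>l. i \<le> l \<Longrightarrow> l < j \<Longrightarrow> (f l, f (Suc l)) \<in> parcs G"
    and "\<And>l m. i \<le> l \<Longrightarrow> Suc l < m \<Longrightarrow> m \<le> j \<Longrightarrow> (f l, f m) \<notin> parcs G"
    and "inj_on f {i..j}" "s \<notin> f ` {i..j}" "(s, f i) \<in> parcs G" "(s, f j) \<in> parcs G"
    and "i \<le> l" "l \<le> j"
  shows "(s, f l) \<in> parcs G"
  using assms(3-)
proof (induction "j - i" arbitrary: i j rule: less_induct)
  case less
  note sym = pair_graph_sym[OF assms(1), THEN symD]
  show ?case
  proof (cases "j \<le> Suc i")
    case True
    then have "l = i \<or> l = j" using less.prems by auto
    then show ?thesis using less.prems by auto
  next
    case False
    define p where "p = (s, f i) # map (\<lambda>l. (f l, f (Suc l))) [i..<j] @ [(f j, s)]"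
    have step: "(f m, f (Suc m)) \<in> set p" if "i \<le> m" "m < j" for m
      using that by (auto simp: p_def)
    have ends: "(s, f i) \<in> set p" "(f j, s) \<in> set p" by (auto simp: p_def)
    have upt: "[i..<Suc j] = [i..<j] @ [j]" using False by simp
    have verts: "map fst p = s # map f [i..<Suc j]"
      unfolding upt by (simp add: p_def comp_def)
    have fstp: "fst ` set p = insert s (f ` {i..j})"
      using arg_cong[OF verts, of set] by (simp add: atLeastLessThanSuc_atLeastAtMost del: upt_Suc)
    have "tl (pawalk_verts s p) = map f [i..<Suc j] @ [s]"
      unfolding pawalk_verts_eq verts by (simp add: p_def del: upt_Suc)
    then have "distinct (tl (pawalk_verts s p))"
      using less.prems(3,4)
      by (simp add: distinct_map atLeastLessThanSuc_atLeastAtMost del: upt_Suc)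
    moreover have "pcas s p s"
      using False pcas_consecutive[of i j f "[(f j, s)]" s] by (simp add: p_def)
    moreover have "set p \<subseteq> parcs G"
      using less.prems(1,5) sym[OF less.prems(6)] by (auto simp: p_def)
    moreover have "s \<in> pverts G"
      using less.prems(5) pair_graph_subset[OF assms(1)] by auto
    moreover have "4 \<le> length p" using False by (simp add: p_def)
    ultimately have "undirected_cycle G p" "4 \<le> length p"
      unfolding undirected_cycle_iff by auto
    then obtain x y where xy: "x \<in> fst ` set p" "y \<in> fst ` set p" "(x, y) \<in> parcs G"
      "(x, y) \<notin> set p" "(y, x) \<notin> set p"
      using assms(2) unfolding chordal_def by metis
    \<comment> \<open>Two path vertices do not form a chord: consecutive ones lie on the cycle, others are not
       adjacent.\<close>
    have no: False if m: "m \<in> {i..j}" "m' \<in> {i..j}" "m < m'" and "(f m, f m') \<in> parcs G" "(f m, f m') \<notin> set p" for m m'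
    proof (cases "m' = Suc m")
      case True
      then show False using step[of m] that by auto
    next
      case False
      then show False using less.prems(2)[of m m'] that by auto
    qed
    have "\<exists>m\<in>{i..j}. m \<noteq> i \<and> m \<noteq> j \<and> (s, f m) \<in> parcs G"
    proof -
      consider "x = s" "y = s" | m where "x = s" "m \<in> {i..j}" "y = f m" | m where "y = s" "m \<in> {i..j}" "x = f m"
        | m m' where "x = f m" "y = f m'" "m \<in> {i..j}" "m' \<in> {i..j}"
        using xy(1,2) unfolding fstp by blast
      then show ?thesis
      proof cases
        case 1
        then show ?thesis using xy(3) pair_graph_irrefl[OF assms(1)] by blast
      next
        case 2
        then show ?thesis using xy ends by metis
      next
        case 3
        then show ?thesis using xy ends sym by metis
      next
        case 4
        then have "m \<noteq> m'" using xy(3) pair_graph_irrefl[OF assms(1)] by auto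
        then show ?thesis using no 4 xy sym by (metis nat_neq_iff)
      qed
    qed
    then obtain m where m: "i < m" "m < j" "(s, f m) \<in> parcs G" by (auto simp: le_less)
    show ?thesis
    proof (cases "l \<le> m")
      case True
      show ?thesis
      proof (rule less.hyps[of m i])
        show "inj_on f {i..m}" by (rule inj_on_subset[OF less.prems(3)]) (use m in auto)
      qed (use less.prems m True in auto)
    next
      case False
      show ?thesis
      proof (rule less.hyps[of j m])
        show "inj_on f {m..j}" by (rule inj_on_subset[OF less.prems(3)]) (use m in auto)
      qed (use less.prems m False in auto)
    qed
  qed
qed

text \<open>
  Adjacency in \<open>G - S\<close>. Since ends of the paths in question lie outside \<open>S\<close>, avoiding \<open>S\<close> with
  the internal vertices amounts to staying in this graph.
\<close>

definition avoiding_adj :: "'a pair_pre_digraph \<Rightarrow> 'a set \<Rightarrow> ('a \<times> 'a) set" where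
  "avoiding_adj G S = parcs G \<inter> (- S) \<times> (- S)"

lemma avoiding_path_iff:
  assumes "u \<notin> S" "v \<notin> S"
  shows "(\<exists>p. avoiding_path G S u p v) \<longleftrightarrow> u \<in> pverts G \<and> (u, v) \<in> (avoiding_adj G S)\<^sup>*"
proof -
  have path_iff: "avoiding_path G S u p v \<longleftrightarrow> u \<in> pverts G \<and> set p \<subseteq> parcs G \<and> pcas u p v \<and>
      distinct (pawalk_verts u p) \<and> set (tl (map fst p)) \<inter> S = {}" for p
    unfolding avoiding_path_def pre_digraph.apath_def pre_digraph.awalk_def inner_verts_with_proj_def
    by (simp add: cas_with_proj_eq awalk_verts_with_proj_eq)
  have walk: "(u, v) \<in> (avoiding_adj G S)\<^sup>*"
    if "pcas u p v" "set p \<subseteq> parcs G" "u \<notin> S" "v \<notin> S" "set (tl (map fst p)) \<inter> S = {}" for u p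
    using that
  proof (induction p arbitrary: u)
    case (Cons e es)
    have "snd e \<notin> S" using Cons.prems by (cases es) auto
    moreover have "set (tl (map fst es)) \<inter> S = {}" using Cons.prems(5) by (cases es) auto
    ultimately have "(snd e, v) \<in> (avoiding_adj G S)\<^sup>*" using Cons by auto
    moreover have "(u, snd e) \<in> avoiding_adj G S"
      using Cons.prems \<open>snd e \<notin> S\<close> by (auto simp: avoiding_adj_def)
    ultimately show ?case by (rule converse_rtrancl_into_rtrancl[rotated])
  qed simp
  show ?thesis
  proof
    assume "\<exists>p. avoiding_path G S u p v"
    then show "u \<in> pverts G \<and> (u, v) \<in> (avoiding_adj G S)\<^sup>*"
      using assms walk unfolding path_iff by blast
  next
    assume "u \<in> pverts G \<and> (u, v) \<in> (avoiding_adj G S)\<^sup>*"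
    moreover from this obtain p where p: "set p \<subseteq> avoiding_adj G S" "pcas u p v" "distinct (pawalk_verts u p)"
      using distinct_path_if_rtrancl by metis
    moreover have "set (tl (map fst p)) \<subseteq> - S"
      using p(1) by (cases p) (auto simp: avoiding_adj_def)
    ultimately show "\<exists>p. avoiding_path G S u p v"
      unfolding path_iff avoiding_adj_def by blast
  qed
qed

lemma clique_adjacent: "clique G K \<Longrightarrow> x \<in> K \<Longrightarrow> y \<in> K \<Longrightarrow> x \<noteq> y \<Longrightarrow> (x, y) \<in> parcs G"
  by (auto simp: clique_def)

lemma maximal_clique_clique: "K \<in> maximal_cliques G \<Longrightarrow> clique G K"
  by (simp add: maximal_cliques_def)

lemma maximal_clique_subset: "K \<in> maximal_cliques G \<Longrightarrow> K \<subseteq> pverts G"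
  by (simp add: maximal_cliques_def clique_def)

lemma finite_maximal_cliques: "finite (pverts G) \<Longrightarrow> finite (maximal_cliques G)"
  by (rule finite_subset[of _ "Pow (pverts G)"]) (auto dest: maximal_clique_subset)

lemma maximal_cliques_antichain:
  "C \<in> maximal_cliques G \<Longrightarrow> D \<in> maximal_cliques G \<Longrightarrow> C \<subseteq> D \<Longrightarrow> C = D"
  unfolding maximal_cliques_def by blast

lemma ex_maximal_clique:
  assumes "finite (pverts G)" "clique G K"
  shows "\<exists>C\<in>maximal_cliques G. K \<subseteq> C"
proof -
  have "finite {C. clique G C}"
    by (rule finite_subset[of _ "Pow (pverts G)"]) (use assms(1) in \<open>auto simp: clique_def\<close>)
  from finite_has_maximal2[OF this, of K] assms(2)
  obtain C where "clique G C" "K \<subseteq> C" "\<And>D. clique G D \<Longrightarrow> C \<subseteq> D \<Longrightarrow> D = C" by auto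
  then show ?thesis unfolding maximal_cliques_def by blast
qed

lemma separating_pair_iff:
  assumes "C \<in> maximal_cliques G"
  shows "separating_pair G C D \<longleftrightarrow>
     (\<forall>u\<in>C - D. \<forall>v\<in>D - C. (u, v) \<notin> (avoiding_adj G (C \<inter> D))\<^sup>*)"
proof -
  have "(\<exists>p. avoiding_path G (C \<inter> D) u p v) \<longleftrightarrow> (u, v) \<in> (avoiding_adj G (C \<inter> D))\<^sup>*"
    if "u \<in> C - D" "v \<in> D - C" for u v
    using that avoiding_path_iff[of u "C \<inter> D" v G] maximal_clique_subset[OF assms] by blast
  then show ?thesis unfolding separating_pair_def by blast
qed

text \<open>
  Let \<open>S = C \<inter> D\<close> and take a shortest walk in \<open>G - S\<close> between a given vertex of \<open>C\<close>
  and one of \<open>D\<close>; it is an induced path. Each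
  \<open>s \<in> S\<close> is adjacent to both ends, because it shares \<open>C\<close> with the first and \<open>D\<close> with the last
  vertex, hence to the whole path. Maximal cliques that contain \<open>S\<close> and two consecutive vertices
  of the path link up, as neighbours share \<open>S\<close> and one path vertex.
\<close>

lemma clique_chain_if_not_separating:
  assumes "pair_graph G" "chordal G" "C \<in> maximal_cliques G" "D \<in> maximal_cliques G"
    and "\<not> separating_pair G C D"
  shows "(C, D) \<in> {(A, B). A \<in> maximal_cliques G \<and> B \<in> maximal_cliques G \<and> C \<inter> D \<subset> A \<inter> B}\<^sup>*"
    (is "_ \<in> ?R\<^sup>*")
proof -
  define S where "S = C \<inter> D"
  obtain u v where uv: "u \<in> C - D" "v \<in> D - C" "(u, v) \<in> (avoiding_adj G S)\<^sup>*"
    using assms(5) separating_pair_iff[OF assms(3)] unfolding S_def by blast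
  obtain f n where f: "f 0 = u" "f n = v" "\<And>i. i < n \<Longrightarrow> (f i, f (Suc i)) \<in> avoiding_adj G S"
    "inj_on f {..n}" "\<And>i j. Suc i < j \<Longrightarrow> j \<le> n \<Longrightarrow> (f i, f j) \<notin> avoiding_adj G S"
    using shortest_walk[OF uv(3)] by metis
  have notS: "f i \<notin> S" if "i \<le> n" for i
  proof (cases i)
    case 0
    then show ?thesis using f(1) uv by (auto simp: S_def)
  next
    case (Suc k)
    then show ?thesis using f(3)[of k] that by (auto simp: avoiding_adj_def)
  qed
  have adj: "(f i, f (Suc i)) \<in> parcs G" if "i < n" for i
    using f(3)[OF that] by (simp add: avoiding_adj_def)
  have adjS: "(s, f i) \<in> parcs G" if s: "s \<in> S" and "i \<le> n" for s i
  proof (rule chordal_adjacent_to_induced_path[OF assms(1,2), of 0 n f s i])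
    show "(f l, f m) \<notin> parcs G" if "0 \<le> l" "Suc l < m" "m \<le> n" for l m
      using f(5)[of l m] notS[of l] notS[of m] that by (auto simp: avoiding_adj_def)
    show "inj_on f {0..n}" using f(4) by (simp add: atMost_atLeast0)
    show "s \<notin> f ` {0..n}" using s notS by auto
    show "(s, f 0) \<in> parcs G" using s uv f(1) assms(3)
      by (auto simp: S_def intro!: clique_adjacent maximal_clique_clique)
    show "(s, f n) \<in> parcs G" using s uv f(2) assms(4)
      by (auto simp: S_def intro!: clique_adjacent maximal_clique_clique)
  qed (use adj that in auto)
  have "(C, E) \<in> ?R\<^sup>*" if "i \<le> n" "E \<in> maximal_cliques G" "insert (f i) S \<subseteq> E" for i E
    using that
  proof (induction i arbitrary: E)
    case 0
    then have "S \<subset> C \<inter> E" using f(1) uv by (auto simp: S_def)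
    then show ?case using assms(3) 0 unfolding S_def by (intro r_into_rtrancl) auto
  next
    case (Suc i)
    let ?K = "insert (f i) (insert (f (Suc i)) S)"
    have "clique G S" using maximal_clique_clique[OF assms(3)] by (auto simp: clique_def S_def)
    then have "clique G ?K"
      using adj[of i] adjS[of _ i] adjS[of _ "Suc i"] Suc.prems(1) pair_graph_sym[OF assms(1)]
        pair_graph_subset[OF assms(1)] unfolding clique_def sym_def by auto
    then obtain E' where E': "E' \<in> maximal_cliques G" "?K \<subseteq> E'"
      using ex_maximal_clique pair_graph_finite[OF assms(1)] by blast
    have "(C, E') \<in> ?R\<^sup>*" using Suc E' by auto
    moreover have "S \<subset> E' \<inter> E" using notS[of "Suc i"] E' Suc.prems by auto
    then have "(E', E) \<in> ?R" using E' Suc.prems by (auto simp: S_def)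
    ultimately show ?case by (rule rtrancl_into_rtrancl)
  qed
  from this[of n D] show ?thesis using f(2) uv assms(4) by (auto simp: S_def)
qed

section \<open>Maximum-weight spanning trees of the reduced clique graph\<close>

lemma undirected_spanning_tree_iff:
  assumes "parcs H \<subseteq> pverts H \<times> pverts H"
  shows "undirected_spanning_tree T H \<longleftrightarrow>
         undirected_tree T \<and> pverts T = pverts H \<and> parcs T \<subseteq> parcs H"
proof -
  have "wf_digraph (with_proj H)" using assms by unfold_locales auto
  moreover have "wf_digraph (with_proj T)" if "undirected_tree T"
    using that pair_graph_subset[of T] unfolding undirected_tree_iff by unfold_locales auto
  ultimately show ?thesis
    unfolding undirected_spanning_tree_def spanning_def subgraph_def by auto
qed

lemma reduced_clique_graph_subset:
  "parcs (reduced_clique_graph G) \<subseteq> pverts (reduced_clique_graph G) \<times> pverts (reduced_clique_graph G)"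
  by (auto simp: reduced_clique_graph_def)

lemma pverts_reduced_clique_graph [simp]: "pverts (reduced_clique_graph G) = maximal_cliques G"
  by (simp add: reduced_clique_graph_def)

lemma reduced_clique_graph_arc_iff:
  "(C, D) \<in> parcs (reduced_clique_graph G) \<longleftrightarrow>
   C \<in> maximal_cliques G \<and> D \<in> maximal_cliques G \<and> C \<noteq> D \<and> C \<inter> D \<noteq> {} \<and> separating_pair G C D"
  by (auto simp: reduced_clique_graph_def)

lemmas spanning_tree_reduced_clique_graph_iff =
  undirected_spanning_tree_iff[OF reduced_clique_graph_subset, unfolded pverts_reduced_clique_graph]

lemma sym_avoiding_adj: "pair_graph G \<Longrightarrow> sym (avoiding_adj G S)"
  using pair_graph_sym[of G] by (auto simp: avoiding_adj_def sym_def)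

lemma sym_reduced_clique_graph:
  assumes "pair_graph G"
  shows "sym (parcs (reduced_clique_graph G))"
proof -
  have "separating_pair G D C"
    if "C \<in> maximal_cliques G" "D \<in> maximal_cliques G" "separating_pair G C D" for C D
    using that sym_rtranclD[OF sym_avoiding_adj[OF assms]]
    unfolding separating_pair_iff[OF that(1)] separating_pair_iff[OF that(2)] by (metis Int_commute)
  then show ?thesis by (auto simp: sym_def reduced_clique_graph_arc_iff)
qed

lemma edges_eq_unordered_pairs: "edges T = unordered_pairs (parcs T)"
  by (simp add: edges_def unordered_pairs_def)

definition cliques_containing :: "'a pair_pre_digraph \<Rightarrow> 'a set \<Rightarrow> 'a set set" where
  "cliques_containing G S = {K \<in> maximal_cliques G. S \<subseteq> K}"

text \<open>
  Double counting of the pairs of a tree edge \<open>{C, D}\<close> and a vertex of \<open>C \<inter> D\<close>.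
\<close>

lemma weight_eq_sum_vertices:
  assumes "finite (pverts G)" "parcs T \<subseteq> maximal_cliques G \<times> maximal_cliques G"
  shows "weight intersection_weight T =
    (\<Sum>v\<in>pverts G. card (unordered_pairs
        (parcs T \<inter> cliques_containing G {v} \<times> cliques_containing G {v})))"
proof -
  have fin: "finite (edges T)"
    unfolding edges_eq_unordered_pairs
    by (rule finite_unordered_pairs, rule finite_subset[OF assms(2)])
      (use finite_maximal_cliques[OF assms(1)] in simp)
  have "intersection_weight e = (\<Sum>v\<in>pverts G. of_bool (v \<in> \<Inter>e))" if "e \<in> edges T" for e
  proof -
    have "\<Inter>e \<subseteq> pverts G"
      using that assms(2) maximal_clique_subset[of _ G] unfolding edges_def by fastforce
    then have "\<Inter>e = {v \<in> pverts G. v \<in> \<Inter>e}" by blast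
    then have "card (\<Inter>e) = card {v \<in> pverts G. v \<in> \<Inter>e}" by simp
    then show ?thesis
      using assms(1) by (simp add: intersection_weight_def Int_def del: Inter_iff)
  qed
  then have "weight intersection_weight T = (\<Sum>e\<in>edges T. \<Sum>v\<in>pverts G. of_bool (v \<in> \<Inter>e))"
    by (simp add: weight_def)
  also have "\<dots> = (\<Sum>v\<in>pverts G. \<Sum>e\<in>edges T. of_bool (v \<in> \<Inter>e))"
    by (rule sum.swap)
  also have "\<dots> = (\<Sum>v\<in>pverts G. card {e \<in> edges T. v \<in> \<Inter>e})"
    using fin by (simp add: Int_def del: Inter_iff)
  also have "\<dots> = (\<Sum>v\<in>pverts G. card (unordered_pairs
        (parcs T \<inter> cliques_containing G {v} \<times> cliques_containing G {v})))"
  proof (rule sum.cong[OF refl], rule arg_cong[where f = card])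
    fix v
    show "{e \<in> edges T. v \<in> \<Inter>e} =
      unordered_pairs (parcs T \<inter> cliques_containing G {v} \<times> cliques_containing G {v})"
      using assms(2) unfolding edges_def unordered_pairs_def cliques_containing_def by auto
  qed
  finally show ?thesis .
qed

lemma cliques_containing_vertex:
  assumes "pair_graph G" "v \<in> pverts G"
  shows "cliques_containing G {v} \<noteq> {}" "finite (cliques_containing G {v})"
proof -
  have "clique G {v}" using assms(2) by (simp add: clique_def)
  then show "cliques_containing G {v} \<noteq> {}"
    using ex_maximal_clique[OF pair_graph_finite[OF assms(1)]] by (auto simp: cliques_containing_def)
  show "finite (cliques_containing G {v})"
    using finite_maximal_cliques[OF pair_graph_finite[OF assms(1)]] by (simp add: cliques_containing_def)
qed

lemma clique_tree_iff:
  assumes "undirected_spanning_tree T (reduced_clique_graph G)"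
  shows "clique_tree G T \<longleftrightarrow> (\<forall>v\<in>pverts G. Digraph_Component.connected (with_proj T \<restriction> cliques_containing G {v}))"
  using assms unfolding clique_tree_def spanning_tree_reduced_clique_graph_iff cliques_containing_def
  by simp

text \<open>
  The comparison holds for each vertex \<open>v\<close> separately: among the \<open>k\<close> cliques containing \<open>v\<close>, the
  connected part of \<open>T\<close> has at least \<open>k - 1\<close> edges and the forest part of \<open>T'\<close> at most that many.
\<close>

lemma weight_le_weight_clique_tree:
  assumes G: "pair_graph G"
    and T: "undirected_spanning_tree T (reduced_clique_graph G)"
    and T': "undirected_spanning_tree T' (reduced_clique_graph G)"
    and "clique_tree G T"
  shows "weight intersection_weight T' \<le> weight intersection_weight T"
proof -
  have tree: "undirected_tree T" "undirected_tree T'"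
    and sub: "parcs T \<subseteq> maximal_cliques G \<times> maximal_cliques G"
       "parcs T' \<subseteq> maximal_cliques G \<times> maximal_cliques G"
    using T T' reduced_clique_graph_subset[of G]
    unfolding spanning_tree_reduced_clique_graph_iff by auto
  show ?thesis
    unfolding weight_eq_sum_vertices[OF pair_graph_finite[OF G] sub(1)]
      weight_eq_sum_vertices[OF pair_graph_finite[OF G] sub(2)]
  proof (rule sum_mono)
    fix v assume v: "v \<in> pverts G"
    let ?K = "cliques_containing G {v}"
    note K = cliques_containing_vertex[OF G v]
    have "card (unordered_pairs (parcs T' \<inter> ?K \<times> ?K)) < card ?K"
    proof (rule all_bridges_card_less[OF K(2,1)])
      show "sym (parcs T' \<inter> ?K \<times> ?K)"
        using tree(2) pair_graph_sym[of T'] by (auto simp: undirected_tree_iff sym_def)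
      show "all_bridges (parcs T' \<inter> ?K \<times> ?K)"
        by (rule all_bridges_mono[of "parcs T'"]) (use tree(2) in \<open>auto simp: undirected_tree_iff\<close>)
    qed simp
    moreover have "card ?K \<le> Suc (card (unordered_pairs (parcs T \<inter> ?K \<times> ?K)))"
    proof (rule connected_card_le[OF K(2,1)])
      have "pair_graph T" using tree(1) by (simp add: undirected_tree_iff)
      then show "(A, B) \<in> (parcs T \<inter> ?K \<times> ?K)\<^sup>*" if "A \<in> ?K" "B \<in> ?K" for A B
        using assms(4) v that connected_induced_iff unfolding clique_tree_iff[OF T] by blast
    qed simp
    ultimately show "card (unordered_pairs (parcs T' \<inter> ?K \<times> ?K)) \<le> card (unordered_pairs (parcs T \<inter> ?K \<times> ?K))"
      by linarith
  qed
qed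

text \<open>
  Otherwise some tree edge separates \<open>C\<close> from \<open>D\<close> and is lighter than \<open>{C, D}\<close>; exchanging it for
  \<open>{C, D}\<close> gives a heavier spanning tree.
\<close>

lemma max_weight_bottleneck:
  assumes G: "pair_graph G"
    and max: "max_weight_spanning_tree intersection_weight T (reduced_clique_graph G)"
    and CD: "(C, D) \<in> parcs (reduced_clique_graph G)"
  shows "(C, D) \<in> {(A, B) \<in> parcs T. card (C \<inter> D) \<le> card (A \<inter> B)}\<^sup>*"
proof (rule ccontr)
  let ?R = "parcs T" and ?Q = "{(A, B) \<in> parcs T. card (C \<inter> D) \<le> card (A \<inter> B)}"
  let ?M = "maximal_cliques G" and ?H = "reduced_clique_graph G"
  assume no: "(C, D) \<notin> ?Q\<^sup>*"
  have span: "undirected_spanning_tree T ?H"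
    and best: "\<And>T'. undirected_spanning_tree T' ?H \<Longrightarrow>
                 weight intersection_weight T' \<le> weight intersection_weight T"
    using max by (auto simp: max_weight_spanning_tree_def)
  have T: "pair_graph T" "?M \<noteq> {}" "\<And>A B. A \<in> ?M \<Longrightarrow> B \<in> ?M \<Longrightarrow> (A, B) \<in> ?R\<^sup>*" "all_bridges ?R"
    "pverts T = ?M" "?R \<subseteq> parcs ?H"
    using span unfolding spanning_tree_reduced_clique_graph_iff undirected_tree_iff by auto
  have symR: "sym ?R" using T(1) by (rule pair_graph_sym)
  have finM: "finite ?M" using pair_graph_finite[OF T(1)] T(5) by simp
  have RM: "?R \<subseteq> ?M \<times> ?M" using pair_graph_subset[OF T(1)] T(5) by simp
  have finR: "finite ?R" using RM finM by (meson finite_SigmaI finite_subset)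
  have CDM: "C \<in> ?M" "D \<in> ?M" "C \<noteq> D" using CD by (auto simp: reduced_clique_graph_arc_iff)
  have "sym ?Q" using symR by (auto simp: sym_def Int_commute)
  then obtain A B where AB: "(A, B) \<in> ?R - ?Q" and sep: "(C, D) \<notin> (delete_edge ?R A B)\<^sup>*"
    using bridge_outside[OF finR symR T(4) _ _ T(3)[OF CDM(1,2)] no] by blast
  let ?E = "delete_edge ?R A B"
  let ?R' = "?E \<union> {(C, D), (D, C)}"
  let ?T' = "\<lparr>pverts = ?M, parcs = ?R'\<rparr>"
  have subE: "?E \<subseteq> ?R" by (auto simp: delete_edge_def)
  have symE: "sym ?E" using symR by (rule sym_delete_edge)
  have "pair_graph ?T'"
    using finM subE RM CDM symE pair_graph_irrefl[OF T(1)]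
    by (intro pair_graphI) (auto simp: sym_def)
  moreover have "all_bridges ?R'"
    using exchange_all_bridges[OF symR T(4) sep] .
  moreover have "(X, Y) \<in> ?R'\<^sup>*" if "X \<in> ?M" "Y \<in> ?M" for X Y
    using exchange_connected[OF symR T(3)[OF CDM(1,2)] sep T(3)[OF that]] .
  ultimately have "undirected_tree ?T'"
    unfolding undirected_tree_iff using T(2) by simp
  moreover have "?R' \<subseteq> parcs ?H"
    using subE T(6) CD sym_reduced_clique_graph[OF G] by (auto dest: symD)
  ultimately have "weight intersection_weight ?T' \<le> weight intersection_weight T"
    by (intro best) (simp add: spanning_tree_reduced_clique_graph_iff)
  moreover have "edges ?T' = insert {C, D} (unordered_pairs ?E)"
    by (auto simp: edges_eq_unordered_pairs unordered_pairs_def)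
  moreover have "{C, D} \<notin> unordered_pairs ?E"
    using sep mem_unordered_pairs[OF symE] by blast
  moreover have "edges T = insert {A, B} (unordered_pairs ?E)" "{A, B} \<notin> unordered_pairs ?E"
    using unordered_pairs_delete_edge[OF symR] AB by (auto simp: edges_eq_unordered_pairs)
  moreover have "finite (unordered_pairs ?E)"
    using finR subE by (intro finite_unordered_pairs) (rule finite_subset)
  ultimately have "card (C \<inter> D) \<le> card (A \<inter> B)"
    by (simp add: weight_def intersection_weight_def)
  then show False using AB by auto
qed

text \<open>
  Consecutive cliques share a vertex outside \<open>S\<close>, and within one clique distinct vertices outside
  \<open>S\<close> are adjacent.
\<close>

lemma avoiding_walk_along_cliques:
  assumes "(A, B) \<in> Q\<^sup>*" "A \<in> maximal_cliques G" "Q \<subseteq> maximal_cliques G \<times> maximal_cliques G"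
    and "\<And>X Y. (X, Y) \<in> Q \<Longrightarrow> \<not> X \<inter> Y \<subseteq> S"
    and "u \<in> A - S" "v \<in> B - S"
  shows "(u, v) \<in> (avoiding_adj G S)\<^sup>*"
proof -
  have inside: "(x, y) \<in> (avoiding_adj G S)\<^sup>*"
    if "K \<in> maximal_cliques G" "x \<in> K - S" "y \<in> K - S" for K x y
    using that clique_adjacent[OF maximal_clique_clique[OF that(1)]]
    by (cases "x = y") (auto simp: avoiding_adj_def)
  from assms(1,6) show ?thesis
  proof (induction arbitrary: v rule: rtrancl_induct)
    case base
    then show ?case using inside assms(2,5) by blast
  next
    case (step X Y)
    then obtain x where "x \<in> X \<inter> Y - S" using assms(4) by blast
    then show ?case
      using step inside[of Y x v] assms(3) by (blast intro: rtrancl_trans)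
  qed
qed

text \<open>
  Clique trees are about singletons \<open>S\<close>, but the induction has to run through all larger
  intersections. Nonemptiness of \<open>S\<close> makes a separating pair with intersection \<open>S\<close> an edge of the
  reduced clique graph.
\<close>

lemma max_weight_cliques_containing_connected:
  assumes G: "pair_graph G" "chordal G"
    and max: "max_weight_spanning_tree intersection_weight T (reduced_clique_graph G)"
    and "S \<noteq> {}" "C \<in> cliques_containing G S" "D \<in> cliques_containing G S"
  shows "(C, D) \<in> (parcs T \<inter> cliques_containing G S \<times> cliques_containing G S)\<^sup>*"
  using assms(4-)
proof (induction "card (pverts G) - card S" arbitrary: S C D rule: less_induct)
  case less
  let ?M = "maximal_cliques G" and ?F = "cliques_containing G S"
  let ?R = "parcs T" and ?RS = "parcs T \<inter> ?F \<times> ?F"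
  have RM: "?R \<subseteq> ?M \<times> ?M"
    using max reduced_clique_graph_subset[of G]
    unfolding max_weight_spanning_tree_def spanning_tree_reduced_clique_graph_iff by auto
  have larger: "(A, B) \<in> ?RS\<^sup>*" if "A \<in> ?M" "B \<in> ?M" "S \<subset> A \<inter> B" for A B
  proof -
    have "A \<inter> B \<subseteq> pverts G" using maximal_clique_subset that by blast
    then have "card S < card (A \<inter> B)" "card (A \<inter> B) \<le> card (pverts G)"
      using that(3) pair_graph_finite[OF G(1)] by (auto intro: psubset_card_mono card_mono finite_subset)
    then have "(A, B) \<in> (?R \<inter> cliques_containing G (A \<inter> B) \<times> cliques_containing G (A \<inter> B))\<^sup>*"
      using that by (intro less.hyps) (auto simp: cliques_containing_def)
    moreover have "cliques_containing G (A \<inter> B) \<subseteq> ?F"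
      using that by (auto simp: cliques_containing_def)
    then have "?R \<inter> cliques_containing G (A \<inter> B) \<times> cliques_containing G (A \<inter> B) \<subseteq> ?RS"
      by blast
    ultimately show ?thesis using rtrancl_mono by blast
  qed
  have nonseparating: "(A, B) \<in> ?RS\<^sup>*" if AB: "A \<in> ?F" "B \<in> ?F" "\<not> (separating_pair G A B \<and> A \<inter> B = S \<and> A \<noteq> B)" for A B
  proof -
    have M: "A \<in> ?M" "B \<in> ?M" "S \<subseteq> A \<inter> B" using AB by (auto simp: cliques_containing_def)
    consider "A = B" | "S \<subset> A \<inter> B" | "A \<inter> B = S" "\<not> separating_pair G A B"
      using AB(3) M(3) by blast
    then show ?thesis
    proof cases
      case 3
      let ?chain = "{(X, Y). X \<in> ?M \<and> Y \<in> ?M \<and> A \<inter> B \<subset> X \<inter> Y}"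
      have "?chain \<subseteq> ?RS\<^sup>*"
      proof
        fix e assume "e \<in> ?chain"
        then obtain X Y where "e = (X, Y)" "X \<in> ?M" "Y \<in> ?M" "S \<subset> X \<inter> Y"
          unfolding 3(1) by blast
        then show "e \<in> ?RS\<^sup>*" using larger by simp
      qed
      then have "?chain\<^sup>* \<subseteq> ?RS\<^sup>*" by (rule rtrancl_subset_rtrancl)
      then show ?thesis using clique_chain_if_not_separating[OF G M(1,2) 3(2)] by blast
    qed (use larger M in auto)
  qed
  show ?case
  proof (cases "separating_pair G C D \<and> C \<inter> D = S \<and> C \<noteq> D")
    case False
    then show ?thesis using nonseparating less.prems by blast
  next
    case True
    then have CDS: "C \<inter> D = S" by blast
    from True have CD: "(C, D) \<in> parcs (reduced_clique_graph G)"
      using less.prems by (auto simp: reduced_clique_graph_arc_iff cliques_containing_def)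
    let ?Q = "{(A, B) \<in> ?R. card (C \<inter> D) \<le> card (A \<inter> B)}"
    let ?Q' = "{(A, B) \<in> ?R. \<not> A \<inter> B \<subseteq> S}"
    \<comment> \<open>Ends of a segment with large intersections are joined in \<open>G - S\<close>, so they are no
       separating pair with intersection \<open>S\<close>.\<close>
    have segment: "(A, B) \<in> ?RS\<^sup>*" if "(A, B) \<in> ?Q'\<^sup>*" "A \<in> ?F" "B \<in> ?F" for A B
    proof (rule nonseparating[OF that(2,3)], rule notI)
      assume sep: "separating_pair G A B \<and> A \<inter> B = S \<and> A \<noteq> B"
      have M: "A \<in> ?M" "B \<in> ?M" using that by (auto simp: cliques_containing_def)
      then obtain u v where "u \<in> A - B" "v \<in> B - A"
        using sep maximal_cliques_antichain by (metis Diff_eq_empty_iff ex_in_conv)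
      moreover from this have "(u, v) \<in> (avoiding_adj G S)\<^sup>*"
        using sep RM by (intro avoiding_walk_along_cliques[OF that(1) M(1)]) auto
      ultimately show False using sep separating_pair_iff[OF M(1)] by blast
    qed
    \<comment> \<open>\<open>A\<close> is the start of the current segment: the clique just after the last edge of the walk
       with intersection \<open>S\<close>, or \<open>C\<close> if there is none yet.\<close>
    have "\<exists>A\<in>?F. (C, A) \<in> ?RS\<^sup>* \<and> (A, X) \<in> ?Q'\<^sup>*" if "(C, X) \<in> ?Q\<^sup>*" for X
      using that
    proof (induction rule: rtrancl_induct)
      case base
      then show ?case using less.prems by blast
    next
      case (step X Y)
      then obtain A where A: "A \<in> ?F" "(C, A) \<in> ?RS\<^sup>*" "(A, X) \<in> ?Q'\<^sup>*" by blast
      show ?case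
      proof (cases "(X, Y) \<in> ?Q'")
        case True
        then show ?thesis using A by (meson rtrancl.rtrancl_into_rtrancl)
      next
        case False
        have "X \<inter> Y = S"
        proof (rule card_seteq)
          show "finite S"
            using less.prems(2) maximal_clique_subset[of C G] pair_graph_finite[OF G(1)]
            by (auto simp: cliques_containing_def intro: finite_subset)
        qed (use False step.hyps(2) CDS in auto)
        then have XY: "X \<in> ?F" "Y \<in> ?F" "(X, Y) \<in> ?RS"
          using step.hyps(2) RM by (auto simp: cliques_containing_def)
        then have "(C, Y) \<in> ?RS\<^sup>*"
          using A segment by (meson rtrancl.rtrancl_into_rtrancl rtrancl_trans)
        then show ?thesis using XY by blast
      qed
    qed
    then obtain A where "A \<in> ?F" "(C, A) \<in> ?RS\<^sup>*" "(A, D) \<in> ?Q'\<^sup>*"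
      using max_weight_bottleneck[OF G(1) max CD] by blast
    then show ?thesis using segment less.prems by (meson rtrancl_trans)
  qed
qed

theorem theorem1p1:
  fixes G :: "'a pair_pre_digraph" and T :: "'a set pair_pre_digraph"
  assumes "pair_graph G"
    and "Digraph_Component.connected (with_proj G)"
    and "chordal G"
    and "undirected_spanning_tree T (reduced_clique_graph G)"
  shows "clique_tree G T \<longleftrightarrow>
         max_weight_spanning_tree intersection_weight T (reduced_clique_graph G)"
proof
  assume "clique_tree G T"
  then show "max_weight_spanning_tree intersection_weight T (reduced_clique_graph G)"
    unfolding max_weight_spanning_tree_def
    using assms(4) weight_le_weight_clique_tree[OF assms(1,4)] by blast
next
  assume max: "max_weight_spanning_tree intersection_weight T (reduced_clique_graph G)"
  have "pair_graph T"
    using assms(4) by (simp add: spanning_tree_reduced_clique_graph_iff undirected_tree_iff)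
  then show "clique_tree G T"
    unfolding clique_tree_iff[OF assms(4)] connected_induced_iff[OF \<open>pair_graph T\<close>]
    using max_weight_cliques_containing_connected[OF assms(1,3) max]
      cliques_containing_vertex[OF assms(1)] by blast
qed

end
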